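(* Let $d\ge2$ and let $\mathcal{X}$ and $\mathcal{Y}$ be any two quantum channels on $\mathbb{C}^{d\times d}$ with $u(\mathcal{X})>0$ and $u(\mathcal{Y})>0$. Then $$\cos[\theta(\mathcal{X})+\theta(\mathcal{Y})]\leq \frac{p(\mathcal{X}\mathcal{Y})}{\sqrt{u(\mathcal{X})u(\mathcal{Y})}}\leq \cos[\theta(\mathcal{X})-\theta(\mathcal{Y})].$$
   Context: A quantum channel on $\mathbb{C}^{d\times d}$ is a completely positive trace-preserving linear map $\mathcal{E}:\mathbb{C}^{d\times d}\to\mathbb{C}^{d\times d}$. Composition is written $\mathcal{X}\mathcal{Y}(\rho)=\mathcal{X}[\mathcal{Y}(\rho)]$. Fix a Hermitian trace-orthonormal basis $B_0=\mathbb{I}_d/\sqrt d,B_1,\ldots,B_{d^2-1}$ of $\mathbb{C}^{d\times d}$ ($\mathrm{Tr}\,B_j^\dagger B_k=\delta_{jk}$). The Liouville representation of $\mathcal{E}$ is the matrix with entries $\mathrm{Tr}(B_j^\dagger\mathcal{E}(B_k))$, $0\le j,k\le d^2-1$; it has block form $\begin{pmatrix}1&0\\ \boldsymbol{\mathcal{E}}_{\rm n}&\boldsymbol{\mathcal{E}}_{\rm u}\end{pmatrix}$, where the $(d^2-1)\times(d^2-1)$ matrix $\boldsymbol{\mathcal{E}}_{\rm u}$ is the unital block. The effective depolarizing constant and the unitarity are $$p(\mathcal{E})=\frac{\mathrm{Tr}\,\boldsymbol{\mathcal{E}}_{\rm u}}{d^2-1},\qquad u(\mathcal{E})=\frac{\mathrm{Tr}\,\boldsymbol{\mathcal{E}}_{\rm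 u}^\dagger\boldsymbol{\mathcal{E}}_{\rm u}}{d^2-1}=\frac{\|\boldsymbol{\mathcal{E}}_{\rm u}\|_F^2}{d^2-1}$$ (these do not depend on the choice of basis). The coherence angle is $\theta(\mathcal{E})=\arccos\big(p(\mathcal{E})/\sqrt{u(\mathcal{E})}\big)$, defined when $u(\mathcal{E})>0$. *)

theory Defs
  imports "HOL-Analysis.Analysis"
begin

definition cmat_scale :: "complex \<Rightarrow> complex^'d^'d \<Rightarrow> complex^'d^'d" where
  "cmat_scale c A = (\<chi> i j. c * A $ i $ j)"

interpretation cmat: vector_space "cmat_scale :: complex \<Rightarrow> complex^'d^'d \<Rightarrow> complex^'d^'d"
  by unfold_locales (simp_all add: cmat_scale_def vec_eq_iff algebra_simps)

definition dagger :: "complex^'d^'d \<Rightarrow> complex^'d^'d" where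
  "dagger A = (\<chi> i j. cnj (A $ j $ i))"

text \<open>
  An element of $M_n(\mathbb{C}) \otimes \mathbb{C}^{d\times d}$ is represented by its
  $n \times n$ array of blocks \<open>M i j\<close> (\<open>i, j < n\<close>), and a vector of
  $\mathbb{C}^n \otimes \mathbb{C}^d$ by its blocks \<open>v i\<close>. Membership in \<open>\<real>\<^sub>\<ge>\<^sub>0\<close> says that
  the quadratic form is real and nonnegative; over the complex numbers this includes
  Hermiticity.
\<close>

definition block_psd :: "nat \<Rightarrow> (nat \<Rightarrow> nat \<Rightarrow> complex^'d^'d) \<Rightarrow> bool" where
  "block_psd n M \<longleftrightarrow>
     (\<forall>v :: nat \<Rightarrow> complex^'d.
        (\<Sum>i<n. \<Sum>j<n. \<Sum>a\<in>UNIV. cnj (v i $ a) * (M i j *v v j) $ a) \<in> \<real>\<^sub>\<ge>\<^sub>0)"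

text \<open>Applying \<open>E\<close> to every block is the ampliation $\mathrm{id}_n \otimes E$.\<close>

definition completely_positive :: "(complex^'d^'d \<Rightarrow> complex^'d^'d) \<Rightarrow> bool" where
  "completely_positive E \<longleftrightarrow>
     (\<forall>n M. block_psd n M \<longrightarrow> block_psd n (\<lambda>i j. E (M i j)))"

definition quantum_channel :: "(complex^'d^'d \<Rightarrow> complex^'d^'d) \<Rightarrow> bool" where
  "quantum_channel E \<longleftrightarrow>
     Vector_Spaces.linear cmat_scale cmat_scale E \<and>
     completely_positive E \<and>
     (\<forall>A. trace (E A) = trace A)"

text \<open>Only the values \<open>B j\<close> with \<open>j < d\<^sup>2\<close> are constrained and used.\<close>

definition hermitian_orthonormal_basis :: "(nat \<Rightarrow> complex^'d^'d) \<Rightarrow> bool" where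
  "hermitian_orthonormal_basis B \<longleftrightarrow>
     B 0 = cmat_scale (1 / complex_of_real (sqrt (real CARD('d)))) (mat 1) \<and>
     (\<forall>j < CARD('d)\<^sup>2. dagger (B j) = B j) \<and>
     (\<forall>j < CARD('d)\<^sup>2. \<forall>k < CARD('d)\<^sup>2.
        trace (dagger (B j) ** B k) = (if j = k then 1 else 0)) \<and>
     cmat.span (B ` {..<CARD('d)\<^sup>2}) = UNIV"

definition liouville ::
  "(nat \<Rightarrow> complex^'d^'d) \<Rightarrow> (complex^'d^'d \<Rightarrow> complex^'d^'d) \<Rightarrow> nat \<Rightarrow> nat \<Rightarrow> complex" where
  "liouville B E j k = trace (dagger (B j) ** E (B k))"

text \<open>
  The unital block consists of the entries \<open>liouville B E j k\<close> with \<open>1 \<le> j, k < d\<^sup>2\<close>.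
  A channel preserves Hermiticity, so its Liouville entries are real in a Hermitian basis
  and \<open>Re\<close> below only changes the type.
\<close>

definition depol_const ::
  "(nat \<Rightarrow> complex^'d^'d) \<Rightarrow> (complex^'d^'d \<Rightarrow> complex^'d^'d) \<Rightarrow> real" where
  "depol_const B E =
     Re (\<Sum>j\<in>{1..<CARD('d)\<^sup>2}. liouville B E j j) / (real CARD('d) ^ 2 - 1)"

definition unitarity ::
  "(nat \<Rightarrow> complex^'d^'d) \<Rightarrow> (complex^'d^'d \<Rightarrow> complex^'d^'d) \<Rightarrow> real" where
  "unitarity B E =
     (\<Sum>j\<in>{1..<CARD('d)\<^sup>2}. \<Sum>k\<in>{1..<CARD('d)\<^sup>2}. (cmod (liouville B E j k))\<^sup>2)
       / (real CARD('d) ^ 2 - 1)"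

definition coherence_angle ::
  "(nat \<Rightarrow> complex^'d^'d) \<Rightarrow> (complex^'d^'d \<Rightarrow> complex^'d^'d) \<Rightarrow> real" where
  "coherence_angle B E = arccos (depol_const B E / sqrt (unitarity B E))"

end

theory Submission
  imports Defs
begin

text \<open>
  Equip the complex matrices indexed by $1, \ldots, d^2-1$ with the real inner product
  $\mathrm{Re}\,\mathrm{Tr}\,A^\dagger B$. Up to normalization, $p(\mathcal{X})/\sqrt{u(\mathcal{X})}$
  and $p(\mathcal{Y})/\sqrt{u(\mathcal{Y})}$ are the cosines of the angles that
  $\boldsymbol{\mathcal{X}}_{\rm u}^\dagger$ and $\boldsymbol{\mathcal{Y}}_{\rm u}$ form with the
  identity matrix. Trace preservation kills the first row of the Liouville matrix outside the
  corner, so that unital blocks multiply under composition, and the middle term is the cosine of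
  the angle between $\boldsymbol{\mathcal{X}}_{\rm u}^\dagger$ and $\boldsymbol{\mathcal{Y}}_{\rm u}$.
  The claim is then the triangle inequality for angles, which is Cauchy--Schwarz for the
  components orthogonal to the identity matrix.
\<close>

text \<open>A matrix is treated as a family over its index pairs, so Cauchy-Schwarz is needed for
  sums: apply it to each term, then to the two families of norms.\<close>

lemma sum_inner_Cauchy_Schwarz:
  fixes f g :: "'i \<Rightarrow> 'a::real_inner"
  shows "\<bar>\<Sum>i\<in>I. f i \<bullet> g i\<bar> \<le> sqrt (\<Sum>i\<in>I. f i \<bullet> f i) * sqrt (\<Sum>i\<in>I. g i \<bullet> g i)"
proof -
  have "\<bar>\<Sum>i\<in>I. f i \<bullet> g i\<bar> \<le> (\<Sum>i\<in>I. \<bar>f i \<bullet> g i\<bar>)"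
    by (rule sum_abs)
  also have "\<dots> \<le> (\<Sum>i\<in>I. \<bar>norm (f i)\<bar> * \<bar>norm (g i)\<bar>)"
    by (intro sum_mono) (simp add: Cauchy_Schwarz_ineq2)
  also have "\<dots> \<le> L2_set (\<lambda>i. norm (f i)) I * L2_set (\<lambda>i. norm (g i)) I"
    by (rule L2_set_mult_ineq)
  finally show ?thesis
    by (simp add: L2_set_def power2_norm_eq_inner)
qed

lemma sum_inner_diff_scaleR:
  fixes f g e :: "'i \<Rightarrow> 'a::real_inner"
  shows "(\<Sum>i\<in>I. (f i - x *\<^sub>R e i) \<bullet> (g i - y *\<^sub>R e i)) =
    (\<Sum>i\<in>I. f i \<bullet> g i) - y * (\<Sum>i\<in>I. f i \<bullet> e i) - x * (\<Sum>i\<in>I. g i \<bullet> e i)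
      + x * y * (\<Sum>i\<in>I. e i \<bullet> e i)"
  by (simp add: algebra_simps inner_commute sum.distrib sum_subtractf sum_distrib_left)

text \<open>Removing the components along \<open>e\<close> leaves residues of norms
  \<open>sqrt (1 - x\<^sup>2)\<close> and \<open>sqrt (1 - y\<^sup>2)\<close>, the sines of the two
  angles, with inner product \<open>t - x * y\<close>. Cauchy-Schwarz for the residues and the
  addition formulas for cosine give both bounds.\<close>

lemma cos_angle_bounds:
  fixes f g e :: "'i \<Rightarrow> 'a::real_inner"
  assumes ff: "(\<Sum>i\<in>I. f i \<bullet> f i) = 1" and gg: "(\<Sum>i\<in>I. g i \<bullet> g i) = 1"
    and ee: "(\<Sum>i\<in>I. e i \<bullet> e i) = 1"
  shows "cos (arccos (\<Sum>i\<in>I. f i \<bullet> e i) + arccos (\<Sum>i\<in>I. g i \<bullet> e i)) \<le> (\<Sum>i\<in>I. f i \<bullet> g i)"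
    and "(\<Sum>i\<in>I. f i \<bullet> g i) \<le> cos (arccos (\<Sum>i\<in>I. f i \<bullet> e i) - arccos (\<Sum>i\<in>I. g i \<bullet> e i))"
proof -
  define x where "x = (\<Sum>i\<in>I. f i \<bullet> e i)"
  define y where "y = (\<Sum>i\<in>I. g i \<bullet> e i)"
  define t where "t = (\<Sum>i\<in>I. f i \<bullet> g i)"
  have "\<bar>x\<bar> \<le> 1" "\<bar>y\<bar> \<le> 1"
    using sum_inner_Cauchy_Schwarz[of f e I] sum_inner_Cauchy_Schwarz[of g e I]
    by (simp_all add: x_def y_def ff gg ee)
  then have trig: "cos (arccos x) = x" "cos (arccos y) = y"
      "sin (arccos x) = sqrt (1 - x\<^sup>2)" "sin (arccos y) = sqrt (1 - y\<^sup>2)"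
    by (simp_all add: cos_arccos_abs sin_arccos_abs)
  have "\<bar>t - x * y\<bar> \<le> sqrt (1 - x\<^sup>2) * sqrt (1 - y\<^sup>2)"
    using sum_inner_Cauchy_Schwarz[of "\<lambda>i. f i - x *\<^sub>R e i" "\<lambda>i. g i - y *\<^sub>R e i" I]
    unfolding sum_inner_diff_scaleR ff gg ee x_def[symmetric] y_def[symmetric] t_def[symmetric]
    by (simp add: power2_eq_square algebra_simps)
  then show "cos (arccos x + arccos y) \<le> t" "t \<le> cos (arccos x - arccos y)"
    by (simp_all add: cos_add cos_diff trig abs_le_iff)
qed

lemma trace_mult_cmat_scale: "trace (A ** cmat_scale c M) = c * trace (A ** M)"
  by (simp add: trace_def matrix_matrix_mult_def cmat_scale_def sum_distrib_left mult_ac)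

lemma trace_mult_add: "trace (A ** (M + N)) = trace (A ** M) + trace (A ** (N :: complex^'d^'d))"
  by (simp add: trace_def matrix_matrix_mult_def sum.distrib distrib_left)

lemma trace_mult_sum: "trace (A ** (\<Sum>k\<in>K. M k)) = (\<Sum>k\<in>K. trace (A ** (M k :: complex^'d^'d)))"
  by (induction K rule: infinite_finite_induct) (simp_all add: trace_mult_add, simp_all add: trace_def)

text \<open>Both sides are linear in \<open>A\<close> and the \<open>B j\<close> span everything, so
  the case \<open>A = B k\<close> suffices, where orthonormality leaves a single term.\<close>

lemma hermitian_orthonormal_basis_expansion:
  fixes B :: "nat \<Rightarrow> complex^'d^'d"
  assumes "hermitian_orthonormal_basis B"
  shows "A = (\<Sum>j<CARD('d)\<^sup>2. cmat_scale (trace (dagger (B j) ** A)) (B j))"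
proof -
  have "A \<in> cmat.span (B ` {..<CARD('d)\<^sup>2})"
    using assms by (simp add: hermitian_orthonormal_basis_def)
  then show ?thesis
  proof (induction rule: cmat.span_induct_alt)
    case base
    show ?case by (simp add: cmat_scale_def vec_eq_iff trace_def)
  next
    case (step c M N)
    then obtain k where k: "k < CARD('d)\<^sup>2" "M = B k" by auto
    have "(\<Sum>j<CARD('d)\<^sup>2. cmat_scale (trace (dagger (B j) ** B k)) (B j))
        = (\<Sum>j<CARD('d)\<^sup>2. if j = k then B j else 0)"
      using assms k(1)
      by (intro sum.cong) (auto simp: hermitian_orthonormal_basis_def)
    then have "M = (\<Sum>j<CARD('d)\<^sup>2. cmat_scale (trace (dagger (B j) ** M)) (B j))"
      using k by simp
    then have "cmat_scale c M =
        (\<Sum>j<CARD('d)\<^sup>2. cmat_scale (c * trace (dagger (B j) ** M)) (B j))"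
      by (metis (no_types, lifting) cmat.scale_scale cmat.scale_sum_right sum.cong)
    with step.IH have "cmat_scale c M + N =
        (\<Sum>j<CARD('d)\<^sup>2. cmat_scale (c * trace (dagger (B j) ** M)) (B j)) +
        (\<Sum>j<CARD('d)\<^sup>2. cmat_scale (trace (dagger (B j) ** N)) (B j))"
      by (rule arg_cong2[where f = plus, rotated])
    also have "\<dots> =
        (\<Sum>j<CARD('d)\<^sup>2. cmat_scale (trace (dagger (B j) ** (cmat_scale c M + N))) (B j))"
      by (simp only: trace_mult_add trace_mult_cmat_scale cmat.scale_left_distrib sum.distrib)
    finally show ?case .
  qed
qed

lemma liouville_comp:
  fixes B :: "nat \<Rightarrow> complex^'d^'d"
  assumes B: "hermitian_orthonormal_basis B"
    and X: "Vector_Spaces.linear cmat_scale cmat_scale X"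
  shows "liouville B (X \<circ> Y) j k = (\<Sum>l<CARD('d)\<^sup>2. liouville B X j l * liouville B Y l k)"
proof -
  interpret X: Vector_Spaces.linear cmat_scale cmat_scale X by (rule X)
  have "X (Y (B k)) = X (\<Sum>l<CARD('d)\<^sup>2. cmat_scale (liouville B Y l k) (B l))"
    using hermitian_orthonormal_basis_expansion[OF B, of "Y (B k)"] by (simp add: liouville_def)
  also have "\<dots> = (\<Sum>l<CARD('d)\<^sup>2. cmat_scale (liouville B Y l k) (X (B l)))"
    by (simp add: X.sum X.scale)
  finally show ?thesis
    by (simp add: liouville_def trace_mult_sum trace_mult_cmat_scale mult.commute)
qed

text \<open>Pairing with \<open>B 0\<close> is the trace up to a factor. The trace of
  \<open>E (B k)\<close> is that of \<open>B k\<close>, which vanishes because \<open>B k\<close> is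
  orthogonal to \<open>B 0\<close>.\<close>

lemma liouville_first_row:
  fixes B :: "nat \<Rightarrow> complex^'d^'d"
  assumes B: "hermitian_orthonormal_basis B" and tp: "\<And>A. trace (E A) = trace A"
    and k: "0 < k" "k < CARD('d)\<^sup>2"
  shows "liouville B E 0 k = 0"
proof -
  define c where "c = 1 / complex_of_real (sqrt (real CARD('d)))"
  have d: "0 < CARD('d)\<^sup>2" by simp
  have "dagger (B 0) = B 0" and "B 0 = cmat_scale c (mat 1)"
    using B d unfolding hermitian_orthonormal_basis_def c_def by blast+
  \<comment> \<open>Cyclicity of the trace moves the multiple of the identity to the right
    factor.\<close>
  then have tr: "trace (dagger (B 0) ** A) = c * trace A" for A
    by (metis trace_mul_sym trace_mult_cmat_scale matrix_mul_rid)
  have "trace (dagger (B 0) ** B k) = 0"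
    using B d k unfolding hermitian_orthonormal_basis_def by (metis less_irrefl)
  then show ?thesis
    by (simp add: liouville_def tr tp)
qed

text \<open>In the product of the full Liouville matrices, the term with inner index 0 contains a
  first-row entry of \<open>Y\<close> and drops out.\<close>

lemma sum_diag_liouville_comp:
  fixes B :: "nat \<Rightarrow> complex^'d^'d"
  assumes B: "hermitian_orthonormal_basis B"
    and X: "Vector_Spaces.linear cmat_scale cmat_scale X" and Y: "\<And>A. trace (Y A) = trace A"
  shows "(\<Sum>j\<in>{1..<CARD('d)\<^sup>2}. liouville B (X \<circ> Y) j j) =
    (\<Sum>j\<in>{1..<CARD('d)\<^sup>2}. \<Sum>k\<in>{1..<CARD('d)\<^sup>2}. liouville B X j k * liouville B Y k j)"
proof (rule sum.cong[OF refl])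
  fix j assume j: "j \<in> {1..<CARD('d)\<^sup>2}"
  have "{..<CARD('d)\<^sup>2} = insert 0 {1..<CARD('d)\<^sup>2}" by auto
  then show "liouville B (X \<circ> Y) j j =
      (\<Sum>k\<in>{1..<CARD('d)\<^sup>2}. liouville B X j k * liouville B Y k j)"
    using j by (simp add: liouville_comp[OF B X] liouville_first_row[OF B Y])
qed

theorem theorem3:
  fixes B :: "nat \<Rightarrow> complex^'d^'d"
    and X Y :: "complex^'d^'d \<Rightarrow> complex^'d^'d"
  assumes "CARD('d) \<ge> 2"
    and "hermitian_orthonormal_basis B"
    and "quantum_channel X" and "quantum_channel Y"
    and "unitarity B X > 0" and "unitarity B Y > 0"
  shows "cos (coherence_angle B X + coherence_angle B Y)
           \<le> depol_const B (X \<circ> Y) / sqrt (unitarity B X * unitarity B Y)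
       \<and> depol_const B (X \<circ> Y) / sqrt (unitarity B X * unitarity B Y)
           \<le> cos (coherence_angle B X - coherence_angle B Y)"
proof -
  define S where "S = {1..<CARD('d)\<^sup>2}"
  define n where "n = real CARD('d) ^ 2 - 1"
  define u where "u = unitarity B X"
  define w where "w = unitarity B Y"
  have d2: "4 \<le> CARD('d)\<^sup>2"
    using power_mono[OF assms(1), of 2] by simp
  then have card_S: "real (card S) = n"
    by (simp add: S_def n_def of_nat_diff)
  have "4 \<le> real CARD('d) ^ 2"
    using d2 by (metis of_nat_le_iff of_nat_numeral of_nat_power)
  then have n: "n > 0" by (simp add: n_def)
  have u: "u > 0" and w: "w > 0" using assms by (simp_all add: u_def w_def)
  have X: "Vector_Spaces.linear cmat_scale cmat_scale X" and Y: "\<And>A. trace (Y A) = trace A"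
    using assms by (auto simp: quantum_channel_def)

  \<comment> \<open>The adjoint unital block of \<open>X\<close>, the unital block of
    \<open>Y\<close> and the identity, scaled to unit vectors: their squared Frobenius norms are
    \<open>n * u\<close>, \<open>n * w\<close> and \<open>n\<close>.\<close>
  define f where "f = (\<lambda>(j, k). (1 / sqrt (n * u)) *\<^sub>R cnj (liouville B X k j))"
  define g where "g = (\<lambda>(j, k). (1 / sqrt (n * w)) *\<^sub>R liouville B Y j k)"
  define e :: "nat \<times> nat \<Rightarrow> complex"
    where "e = (\<lambda>(j, k). if j = k then complex_of_real (1 / sqrt n) else 0)"

  have sum_u: "(\<Sum>j\<in>S. \<Sum>k\<in>S. (cmod (liouville B X j k))\<^sup>2) = n * u"
    and sum_w: "(\<Sum>j\<in>S. \<Sum>k\<in>S. (cmod (liouville B Y j k))\<^sup>2) = n * w"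
    using n by (simp_all add: u_def w_def unitarity_def n_def S_def)
  have norm_sq: "(a *\<^sub>R z) \<bullet> (a *\<^sub>R z) = a\<^sup>2 * (cmod z)\<^sup>2" for a :: real and z
    by (simp add: power2_norm_eq_inner) (simp add: power2_eq_square)

  have "(\<Sum>i\<in>S\<times>S. f i \<bullet> f i) = (\<Sum>j\<in>S. \<Sum>k\<in>S. (cmod (liouville B X k j))\<^sup>2) / (n * u)"
    using n u by (simp add: f_def sum.cartesian_product' norm_sq sum_divide_distrib power_divide
        del: inner_scaleR_left inner_scaleR_right)
  also have "(\<Sum>j\<in>S. \<Sum>k\<in>S. (cmod (liouville B X k j))\<^sup>2) = n * u"
    using sum_u by (subst sum.swap)
  finally have ff: "(\<Sum>i\<in>S\<times>S. f i \<bullet> f i) = 1"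
    using n u by simp
  have "(\<Sum>i\<in>S\<times>S. g i \<bullet> g i) = (\<Sum>j\<in>S. \<Sum>k\<in>S. (cmod (liouville B Y j k))\<^sup>2) / (n * w)"
    using n w by (simp add: g_def sum.cartesian_product' norm_sq sum_divide_distrib power_divide
        del: inner_scaleR_left inner_scaleR_right)
  then have gg: "(\<Sum>i\<in>S\<times>S. g i \<bullet> g i) = 1"
    using sum_w n w by simp
  have e_right: "(\<Sum>i\<in>S\<times>S. h i \<bullet> e i) = (\<Sum>j\<in>S. Re (h (j, j))) / sqrt n" for h
  proof -
    have "h (j, k) \<bullet> e (j, k) = (if j = k then Re (h (j, k)) / sqrt n else 0)" for j k
      by (simp add: e_def inner_complex_def)
    then show ?thesis
      by (simp add: sum.cartesian_product' S_def sum_divide_distrib)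
  qed
  have ee: "(\<Sum>i\<in>S\<times>S. e i \<bullet> e i) = 1"
    using n by (simp add: e_right) (simp add: e_def card_S real_div_sqrt)

  have depol: "depol_const B E = (\<Sum>j\<in>S. Re (liouville B E j j)) / n" for E
    by (simp add: depol_const_def S_def n_def)
  \<comment> \<open>Taking the adjoint only conjugates the diagonal, which leaves its real part
    unchanged.\<close>
  have fe: "(\<Sum>i\<in>S\<times>S. f i \<bullet> e i) = depol_const B X / sqrt u"
    using n by (simp add: e_right f_def depol sum_divide_distrib[symmetric] real_sqrt_mult)
  have ge: "(\<Sum>i\<in>S\<times>S. g i \<bullet> e i) = depol_const B Y / sqrt w"
    using n by (simp add: e_right g_def depol sum_divide_distrib[symmetric] real_sqrt_mult)

  have "f (j, k) \<bullet> g (j, k) = Re (liouville B X k j * liouville B Y j k) / (n * sqrt (u * w))"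
    for j k
  proof -
    \<comment> \<open>The inner product conjugates one factor, which undoes the conjugation in
      \<open>f\<close>; what remains are the terms of the trace of a matrix product.\<close>
    have "(a *\<^sub>R cnj x) \<bullet> (b *\<^sub>R y) = (a * b) * Re (x * y)" for a b x y
      by (simp add: inner_complex_def algebra_simps)
    moreover have "1 / sqrt (n * u) * (1 / sqrt (n * w)) = 1 / (n * sqrt (u * w))"
      using n by (simp add: real_sqrt_mult)
    ultimately show ?thesis
      by (simp only: f_def g_def prod.case) simp
  qed
  then have "(\<Sum>i\<in>S\<times>S. f i \<bullet> g i) =
      (\<Sum>j\<in>S. \<Sum>k\<in>S. Re (liouville B X k j * liouville B Y j k)) / (n * sqrt (u * w))"
    by (simp only: sum.cartesian_product' sum_divide_distrib)
  also have "\<dots> = Re (\<Sum>j\<in>S. \<Sum>k\<in>S. liouville B X j k * liouville B Y k j) / (n * sqrt (u * w))"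
    by (subst sum.swap) simp
  also have "\<dots> = depol_const B (X \<circ> Y) / sqrt (u * w)"
    unfolding depol_const_def S_def n_def sum_diag_liouville_comp[OF assms(2) X Y] by simp
  finally have fg: "(\<Sum>i\<in>S\<times>S. f i \<bullet> g i) = depol_const B (X \<circ> Y) / sqrt (u * w)" .

  show ?thesis
    using cos_angle_bounds[OF ff gg ee]
    unfolding fe ge fg coherence_angle_def u_def[symmetric] w_def[symmetric] by blast
qed

end
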